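(* For members $i\in\mathcal N$ with continuous-time dynamics $x'=f_i(x,u)$, $u\in U(x)$, and constraint set $K$, let $H=\bigcap_{i\in\mathcal N}\mathrm{Viab}_i(K)$ and let $\tilde U(x)=\bigcap_{i\in\mathcal N}\tilde U_i(x)$ for $x\in H$, where $\tilde U_i$ is member $i$'s viable regulation map on $\mathrm{Viab}_i(K)$. Then the condition $\mathrm{Dom}(\tilde U)=H$ is not sufficient for $H$ to be a viable set for all members: there exist such data with $\mathrm{Dom}(\tilde U)=H$ but $H$ not viable for some member.
   Context: $\mathrm{Viab}_i(K)$ is the viability kernel of $K$ for member $i$'s system: the set of $x\in K$ from which some evolution of $x'=f_i(x,u)$, $u\in U(x)$, stays in $K$ forever. A viable regulation map $\tilde U_i$ on $\mathrm{Viab}_i(K)$ associates to each state the admissible controls that are viable, i.e. controls $u\in U(x)$ under which the evolution can be kept in $\mathrm{Viab}_i(K)$ (all of $U(x)$ in the interior of the kernel). $\mathrm{Dom}(\tilde U)=\{x:\tilde U(x)\neq\emptyset\}$. A set $H$ is viable for a member if from every $x\in H$ some evolution of that member's system stays in $H$ forever. *)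

theory Defs
  imports "HOL-Analysis.Analysis"
begin

definition evolution ::
  "('a::real_normed_vector \<Rightarrow> 'c \<Rightarrow> 'a) \<Rightarrow> ('a \<Rightarrow> 'c set) \<Rightarrow> 'a \<Rightarrow> (real \<Rightarrow> 'a) \<Rightarrow> bool" where
  "evolution f U x0 x \<longleftrightarrow> x 0 = x0 \<and>
     (\<forall>t\<ge>0. \<exists>u\<in>U (x t). (x has_vector_derivative f (x t) u) (at t within {0..}))"

definition viable_from ::
  "('a::real_normed_vector \<Rightarrow> 'c \<Rightarrow> 'a) \<Rightarrow> ('a \<Rightarrow> 'c set) \<Rightarrow> 'a set \<Rightarrow> 'a \<Rightarrow> bool" where
  "viable_from f U S x0 \<longleftrightarrow> (\<exists>x. evolution f U x0 x \<and> (\<forall>t\<ge>0. x t \<in> S))"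

definition Viab ::
  "('a::real_normed_vector \<Rightarrow> 'c \<Rightarrow> 'a) \<Rightarrow> ('a \<Rightarrow> 'c set) \<Rightarrow> 'a set \<Rightarrow> 'a set" where
  "Viab f U K = {x0 \<in> K. viable_from f U K x0}"

definition viable_set ::
  "('a::real_normed_vector \<Rightarrow> 'c \<Rightarrow> 'a) \<Rightarrow> ('a \<Rightarrow> 'c set) \<Rightarrow> 'a set \<Rightarrow> bool" where
  "viable_set f U H \<longleftrightarrow> (\<forall>x0\<in>H. viable_from f U H x0)"

definition contingent_cone :: "'a::real_normed_vector set \<Rightarrow> 'a \<Rightarrow> 'a set" where
  "contingent_cone S x = {v. \<exists>h w. (\<forall>n. h n > 0) \<and> h \<longlonglongrightarrow> 0 \<and> w \<longlonglongrightarrow> v \<and>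
        (\<forall>n. x + h n *\<^sub>R w n \<in> S)}"

text \<open>Viable regulation map on Viab(K): the admissible controls whose velocity is
  contingent to the viability kernel (all of U(x) in the interior of the kernel);
  empty outside the kernel.\<close>
definition viable_reg ::
  "('a::real_normed_vector \<Rightarrow> 'c \<Rightarrow> 'a) \<Rightarrow> ('a \<Rightarrow> 'c set) \<Rightarrow> 'a set \<Rightarrow> 'a \<Rightarrow> 'c set" where
  "viable_reg f U K x =
     (if x \<in> Viab f U K then {u \<in> U x. f x u \<in> contingent_cone (Viab f U K) x} else {})"

end

theory Submission
  imports Defs
begin

text \<open>Two members share K = [0,2] and ignore their controls: member 0 follows x' = -x, and
  member 1 moves down at unit speed below 1 and rests on [1,2]. Their kernels are K and [1,2],
  so H = [1,2]. Both kernels are convex and both velocity fields point into them, so every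
  control is viable for both members at every point of H, and the intersected regulation map
  has domain H. Yet member 0, started at 1, leaves H at once.\<close>

lemma decreases_at_rate:
  fixes x :: "real \<Rightarrow> real"
  assumes der: "\<And>t. 0 \<le> t \<Longrightarrow> t \<le> T \<Longrightarrow> (x has_vector_derivative x' t) (at t within {0..})"
    and rate: "\<And>t. 0 \<le> t \<Longrightarrow> t \<le> T \<Longrightarrow> x' t \<le> - c"
    and "0 \<le> T"
  shows "x T \<le> x 0 - c * T"
proof -
  define g where "g t = x t + c * t" for t
  have g_der: "(g has_derivative (*) (x' t + c)) (at t within {0..T})" if "0 \<le> t" "t \<le> T" for t
  proof -
    have "(x has_field_derivative x' t) (at t within {0..})"
      using der[OF that] by (simp add: has_real_derivative_iff_has_vector_derivative)
    then have "(x has_field_derivative x' t) (at t within {0..T})"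
      by (rule DERIV_subset) auto
    then have "(g has_field_derivative (x' t + c)) (at t within {0..T})"
      unfolding g_def by (auto intro!: derivative_eq_intros)
    then show ?thesis by (simp add: has_field_derivative_def)
  qed
  obtain s where s: "s \<in> {0..T}" "g T - g 0 = (x' s + c) * T"
    using mvt_very_simple[OF \<open>0 \<le> T\<close> g_der] by auto
  have "x' s + c \<le> 0" using rate s(1) by fastforce
  with \<open>0 \<le> T\<close> s(2) have "g T - g 0 \<le> 0" by (simp add: mult_nonpos_nonneg)
  then show ?thesis unfolding g_def by simp
qed

lemma evolution_has_vector_derivative:
  assumes "evolution f U x0 x" "\<And>y u. f y u = F y" "0 \<le> t"
  shows "(x has_vector_derivative F (x t)) (at t within {0..})"
  using assms unfolding evolution_def by auto

lemma evolution_const: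
  assumes "u \<in> U x0" "f x0 u = 0"
  shows "evolution f U x0 (\<lambda>_. x0)"
  using assms unfolding evolution_def by (auto intro!: bexI[of _ u])

lemma convex_diff_in_contingent_cone:
  assumes "convex S" "x \<in> S" "y \<in> S"
  shows "y - x \<in> contingent_cone S x"
  unfolding contingent_cone_def
proof (intro CollectI exI[of _ "\<lambda>n. inverse (real (Suc n))"] exI[of _ "\<lambda>_. y - x"] conjI allI)
  fix n
  let ?h = "inverse (real (Suc n))"
  have "0 < ?h" "?h \<le> 1" by (auto simp: field_simps)
  then have "(1 - ?h) *\<^sub>R x + ?h *\<^sub>R y \<in> S"
    using assms by (intro convexD) auto
  then show "x + ?h *\<^sub>R (y - x) \<in> S" by (simp add: algebra_simps)
qed (use LIMSEQ_inverse_real_of_nat in auto)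

definition contraction :: "real \<Rightarrow> 'c \<Rightarrow> real" where
  "contraction y u = - y"

definition descent_to_one :: "real \<Rightarrow> 'c \<Rightarrow> real" where
  "descent_to_one y u = (if y < 1 then -1 else 0)"

lemma Viab_contraction:
  assumes "\<And>y. U y \<noteq> {}"
  shows "Viab contraction U {0..a} = {0..a}"
proof -
  have "viable_from contraction U {0..a} x0" if "x0 \<in> {0..a}" for x0
    unfolding viable_from_def
  proof (intro exI conjI allI impI)
    show "evolution contraction U x0 (\<lambda>t. x0 * exp (- t))"
      using assms unfolding evolution_def contraction_def
      by (auto intro!: derivative_eq_intros
          simp: has_real_derivative_iff_has_vector_derivative[symmetric])
    fix t :: real
    assume "0 \<le> t"
    then have "x0 * exp (- t) \<le> x0 * 1"
      using that by (intro mult_left_mono) auto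
    then show "x0 * exp (- t) \<in> {0..a}" using that by auto
  qed
  then show ?thesis unfolding Viab_def by auto
qed

lemma not_viable_set_contraction:
  assumes "0 < a" "a \<le> b"
  shows "\<not> viable_set contraction U {a..b}"
proof
  assume "viable_set contraction U {a..b}"
  then obtain x where ev: "evolution contraction U a x" and stays: "\<forall>t\<ge>0. x t \<in> {a..b}"
    using assms unfolding viable_set_def viable_from_def by force
  have "x 1 \<le> x 0 - a * 1"
  proof (rule decreases_at_rate)
    fix t :: real
    assume "0 \<le> t"
    show "(x has_vector_derivative - x t) (at t within {0..})"
      using evolution_has_vector_derivative[OF ev _ \<open>0 \<le> t\<close>] by (simp add: contraction_def)
    show "- x t \<le> - a" using stays \<open>0 \<le> t\<close> by auto
  qed simp
  moreover have "x 0 = a" using ev unfolding evolution_def by simp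
  moreover have "x 1 \<ge> a" using stays by simp
  ultimately show False using \<open>0 < a\<close> by simp
qed

lemma descent_to_one_below_one:
  assumes ev: "evolution descent_to_one U x0 x" and "x0 < 1" "0 \<le> t"
  shows "x t \<le> x0 - t"
proof -
  have x0: "x 0 = x0" using ev unfolding evolution_def by simp
  have der: "(x has_vector_derivative (if x s < 1 then -1 else 0)) (at s within {0..})" if "0 \<le> s" for s
    using evolution_has_vector_derivative[OF ev _ that, of "\<lambda>y. if y < 1 then -1 else 0"]
    by (simp add: descent_to_one_def)
  have nonincreasing: "x s \<le> x0" if "0 \<le> s" for s
    using decreases_at_rate[where c = 0, OF der _ that] x0 by simp
  have "x t \<le> x 0 - 1 * t"
  proof (rule decreases_at_rate[OF der _ \<open>0 \<le> t\<close>])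
    fix s :: real
    assume "0 \<le> s"
    then show "(if x s < 1 then -1 else 0) \<le> (- 1 :: real)"
      using nonincreasing \<open>x0 < 1\<close> by fastforce
  qed
  then show ?thesis using x0 by simp
qed

lemma Viab_descent_to_one:
  assumes "\<And>y. U y \<noteq> {}"
  shows "Viab descent_to_one U {0..b} = {1..b}"
proof -
  have "viable_from descent_to_one U {0..b} x0" if "x0 \<in> {1..b}" for x0
  proof -
    obtain u where "u \<in> U x0" using assms by blast
    then have "evolution descent_to_one U x0 (\<lambda>_. x0)"
      using that by (intro evolution_const) (auto simp: descent_to_one_def)
    then show ?thesis using that unfolding viable_from_def by auto
  qed
  moreover have "\<not> viable_from descent_to_one U {0..b} x0" if "x0 < 1" for x0
  proof
    assume "viable_from descent_to_one U {0..b} x0"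
    then obtain x where ev: "evolution descent_to_one U x0 x" and stays: "\<forall>t\<ge>0. x t \<in> {0..b}"
      unfolding viable_from_def by blast
    have "x 1 \<le> x0 - 1" using descent_to_one_below_one[OF ev that] by simp
    moreover have "x 1 \<ge> 0" using stays by simp
    ultimately show False using that by simp
  qed
  ultimately show ?thesis unfolding Viab_def by force
qed

theorem corollary1:
  shows "\<exists>(N :: nat set) (f :: nat \<Rightarrow> real \<Rightarrow> real \<Rightarrow> real) (U :: real \<Rightarrow> real set) (K :: real set).
     finite N \<and> N \<noteq> {} \<and>
     (let H = (\<Inter>i\<in>N. Viab (f i) U K);
          Ut = (\<lambda>x. \<Inter>i\<in>N. viable_reg (f i) U K x)
      in {x \<in> H. Ut x \<noteq> {}} = H \<and> (\<exists>i\<in>N. \<not> viable_set (f i) U H))"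
proof -
  define f :: "nat \<Rightarrow> real \<Rightarrow> real \<Rightarrow> real" where
    "f i = (if i = 0 then contraction else descent_to_one)" for i
  let ?U = "\<lambda>_. UNIV :: real set" and ?K = "{0..2::real}" and ?N = "{0, Suc 0}"
  have Viab0: "Viab contraction ?U ?K = ?K" and Viab1: "Viab descent_to_one ?U ?K = {1..2}"
    by (simp_all add: Viab_contraction Viab_descent_to_one)
  then have H: "(\<Inter>i\<in>?N. Viab (f i) ?U ?K) = {1..2}" by (auto simp: f_def)
  have "0 \<in> viable_reg (f i) ?U ?K x" if "i \<in> ?N" "x \<in> {1..2}" for i x
    using that convex_diff_in_contingent_cone[of ?K x 0] convex_diff_in_contingent_cone[of "{1..2}" x x]
    by (auto simp: viable_reg_def Viab0 Viab1 f_def contraction_def descent_to_one_def)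
  then have "{x \<in> {1..2}. (\<Inter>i\<in>?N. viable_reg (f i) ?U ?K x) \<noteq> {}} = {1..2}" by blast
  moreover have "\<not> viable_set (f 0) ?U {1..2}"
    by (simp add: f_def not_viable_set_contraction)
  ultimately show ?thesis
    unfolding Let_def by (intro exI[of _ ?N] exI[of _ f] exI[of _ ?U] exI[of _ ?K]) (unfold H, blast)
qed

end
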